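(* Let $S=\sum_{i=1}^n X_i$, where $X_i\sim\mathrm{Bernoulli}(p_i)$, $p_i\in[0,1]$, are independent. Let $k\le\mathbb{E}[S]$ be a positive integer, let $\lambda=\mathbb{E}[S]$ and $\gamma=\mathbb{E}[S]/k\ge1$. Then \[\Pr[S\le k-1]\le e^{-\lambda}\sum_{i=0}^{k-1}\frac{\lambda^i}{i!}\le e^{-\gamma}(e/2).\] *)

theory Defs
  imports "HOL-Probability.Probability"
begin

definition (in prob_space) bernoulli_distributed :: "('a \<Rightarrow> real) \<Rightarrow> real \<Rightarrow> bool" where
  "bernoulli_distributed X p \<longleftrightarrow>
     random_variable borel X \<and>
     distr M borel X = distr (measure_pmf (bernoulli_pmf p)) borel of_bool"

end

theory Submission
  imports Defs
begin

text \<open>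
  Let \<open>V\<close> be a sum of independent Bernoulli variables and let \<open>\<phi>(\<theta>)\<close> be the probability that \<open>V\<close> plus
  an independent Poisson(\<open>\<theta>\<close>) variable is at most \<open>c\<close>; write \<open>w\<^sub>c\<close> for the probability that it equals
  \<open>c\<close>. Then \<open>\<phi>' = -w\<^sub>c\<close> and \<open>\<phi>'' = w\<^sub>c - w\<^sub>c\<^sub>-\<^sub>1\<close>, which is nonnegative as long as the mean is at least
  \<open>c\<close>, so that \<open>\<phi>\<close> is convex there. Adding a Bernoulli(\<open>q\<close>) variable to \<open>V\<close> gives \<open>\<phi>(\<theta>) + q \<phi>'(\<theta>)\<close>,
  the value of the tangent, whereas adding a Poisson(\<open>q\<close>) variable gives \<open>\<phi>(\<theta> + q)\<close>, which is larger.
  The Bernoulli variables can thus be replaced by Poisson variables one at a time.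

  For the second inequality, \<open>e\<^sup>x\<^sup>/\<^sup>k P(Poisson(x) < k)\<close> is nonincreasing for \<open>x \<ge> k\<close>, and
  \<open>P(Poisson(k) < k) \<le> 1/2\<close> because \<open>P(Poisson(k e\<^sup>s) < k) + P(Poisson(k e\<^sup>-\<^sup>s) < k)\<close> increases to 1
  as \<open>s\<close> tends to infinity.
\<close>

unbundle no vec_syntax
unbundle fps_syntax

section \<open>Power series\<close>

lemma fps_deriv_prod:
  fixes f :: "'i \<Rightarrow> 'a::comm_semiring_1 fps"
  shows "fps_deriv (\<Prod>i\<in>I. f i) = (\<Sum>i\<in>I. fps_deriv (f i) * (\<Prod>j\<in>I - {i}. f j))"
proof (induction I rule: infinite_finite_induct)
  case (insert i I)
  have "(\<Prod>k\<in>insert i I - {j}. f k) = f i * (\<Prod>k\<in>I - {j}. f k)" if "j \<in> I" for j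
  proof -
    have "insert i I - {j} = insert i (I - {j})" using that insert.hyps by auto
    then show ?thesis using insert.hyps by simp
  qed
  then have "(\<Sum>j\<in>I. fps_deriv (f j) * (\<Prod>k\<in>insert i I - {j}. f k)) = f i * fps_deriv (\<Prod>j\<in>I. f j)"
    unfolding insert.IH sum_distrib_left by (intro sum.cong) (simp_all add: mult.left_commute)
  then show ?case using insert.hyps by (simp add: add.commute)
qed simp_all

definition cumulative_fps :: "'a::field fps \<Rightarrow> 'a fps" where
  "cumulative_fps F = inverse (1 - fps_X) * F"

lemma cumulative_fps_nth: "cumulative_fps F $ c = (\<Sum>i\<le>c. F $ i)"
  by (simp add: cumulative_fps_def fps_inverse_one_minus_fps_X mult.commute[of _ F]
      fps_mult_nth atMost_atLeast0)

lemma cumulative_fps_mult_left: "cumulative_fps (F * G) = F * cumulative_fps G"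
  by (simp add: cumulative_fps_def mult.left_commute)

lemma cumulative_fps_mult_right: "cumulative_fps (F * G) = cumulative_fps F * G"
  by (simp add: cumulative_fps_def mult.assoc)

lemma one_minus_fps_X_mult_cumulative_fps: "(1 - fps_X) * cumulative_fps F = F"
  by (simp add: cumulative_fps_def inverse_mult_eq_1' flip: mult.assoc)

section \<open>Generating functions of Bernoulli and Poisson variables\<close>

definition bernoulli_pgf :: "real \<Rightarrow> real fps" where
  "bernoulli_pgf q = fps_const (1 - q) + fps_const q * fps_X"

lemma bernoulli_pgf_mult: "bernoulli_pgf q * F = F - fps_const q * ((1 - fps_X) * F)"
  by (simp add: bernoulli_pgf_def algebra_simps flip: fps_const_sub)

lemma bernoulli_pgf_mult_nth:
  "(bernoulli_pgf q * F) $ c = (1 - q) * F $ c + q * (if c = 0 then 0 else F $ (c - 1))"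
  by (simp add: bernoulli_pgf_def distrib_right mult.assoc)

lemma cumulative_bernoulli_pgf_mult:
  "cumulative_fps (bernoulli_pgf q * F) = cumulative_fps F - fps_const q * F"
  by (simp only: cumulative_fps_mult_left bernoulli_pgf_mult[of q "cumulative_fps F"]
      one_minus_fps_X_mult_cumulative_fps)

definition poisson_pgf :: "real \<Rightarrow> real fps" where
  "poisson_pgf \<theta> = fps_const (exp (- \<theta>)) * fps_exp \<theta>"

lemma poisson_pgf_nth: "poisson_pgf \<theta> $ c = exp (- \<theta>) * \<theta> ^ c / fact c"
  by (simp add: poisson_pgf_def)

lemma poisson_pgf_0: "poisson_pgf 0 = 1"
  by (simp add: poisson_pgf_def)

lemma fps_deriv_poisson_pgf: "fps_deriv (poisson_pgf \<theta>) = fps_const \<theta> * poisson_pgf \<theta>"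
  by (simp add: poisson_pgf_def mult_ac)

lemma DERIV_poisson_pgf_nth:
  "((\<lambda>\<theta>. poisson_pgf \<theta> $ c) has_real_derivative ((fps_X - 1) * poisson_pgf \<theta>) $ c) (at \<theta>)"
proof (cases c)
  case 0
  then show ?thesis
    by (auto simp: poisson_pgf_nth left_diff_distrib intro!: derivative_eq_intros)
next
  case (Suc m)
  have "((\<lambda>\<theta>. exp (- \<theta>) * \<theta> ^ Suc m / fact (Suc m)) has_real_derivative
      (exp (- \<theta>) * (real (Suc m) * \<theta> ^ m) - exp (- \<theta>) * \<theta> ^ Suc m) / fact (Suc m)) (at \<theta>)"
    by (intro DERIV_cdivide) (auto intro!: derivative_eq_intros simp del: power_Suc)
  moreover have "exp (- \<theta>) * (real (Suc m) * \<theta> ^ m) / fact (Suc m) = exp (- \<theta>) * \<theta> ^ m / fact m"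
    by (simp add: fact_Suc del: of_nat_Suc)
  ultimately show ?thesis
    using Suc by (simp add: poisson_pgf_nth left_diff_distrib diff_divide_distrib)
qed

lemma DERIV_mult_poisson_pgf_nth:
  "((\<lambda>\<theta>. (F * poisson_pgf \<theta>) $ c) has_real_derivative
    - (((1 - fps_X) * (F * poisson_pgf \<theta>)) $ c)) (at \<theta>)"
proof -
  have "((\<lambda>\<theta>. (F * poisson_pgf \<theta>) $ c) has_real_derivative (F * ((fps_X - 1) * poisson_pgf \<theta>)) $ c)
      (at \<theta>)"
    unfolding fps_mult_nth[of F] by (intro DERIV_sum DERIV_cmult DERIV_poisson_pgf_nth)
  moreover have "F * ((fps_X - 1) * poisson_pgf \<theta>) = - ((1 - fps_X) * (F * poisson_pgf \<theta>))"
    by (simp add: algebra_simps)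
  ultimately show ?thesis by simp
qed

definition poisson_cdf :: "nat \<Rightarrow> real \<Rightarrow> real" where
  "poisson_cdf m x = cumulative_fps (poisson_pgf x) $ m"

lemma poisson_cdf_eq: "poisson_cdf m x = exp (- x) * (\<Sum>i = 0..m. x ^ i / fact i)"
  by (simp add: poisson_cdf_def cumulative_fps_nth poisson_pgf_nth sum_distrib_left atMost_atLeast0)

section \<open>Replacing Bernoulli summands by Poisson summands\<close>

definition bernoulli_poisson_pgf :: "('i \<Rightarrow> real) \<Rightarrow> 'i set \<Rightarrow> real \<Rightarrow> real fps" where
  "bernoulli_poisson_pgf p I \<theta> = (\<Prod>i\<in>I. bernoulli_pgf (p i)) * poisson_pgf \<theta>"

lemma bernoulli_poisson_pgf_empty: "bernoulli_poisson_pgf p {} \<theta> = poisson_pgf \<theta>"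
  by (simp add: bernoulli_poisson_pgf_def)

lemma bernoulli_poisson_pgf_insert:
  assumes "finite I" "i \<notin> I"
  shows "bernoulli_poisson_pgf p (insert i I) \<theta> = bernoulli_pgf (p i) * bernoulli_poisson_pgf p I \<theta>"
  using assms by (simp add: bernoulli_poisson_pgf_def mult.assoc)

lemma bernoulli_poisson_pgf_remove:
  assumes "finite I" "i \<in> I"
  shows "bernoulli_poisson_pgf p I \<theta> = bernoulli_pgf (p i) * bernoulli_poisson_pgf p (I - {i}) \<theta>"
  using bernoulli_poisson_pgf_insert[of "I - {i}" i p \<theta>] assms by (simp add: insert_absorb)

lemma bernoulli_poisson_pgf_nth_nonneg:
  assumes "finite I" "\<And>i. i \<in> I \<Longrightarrow> p i \<in> {0..1}" "0 \<le> \<theta>"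
  shows "0 \<le> bernoulli_poisson_pgf p I \<theta> $ c"
  using assms
proof (induction I arbitrary: c rule: finite_induct)
  case empty
  then show ?case by (simp add: bernoulli_poisson_pgf_empty poisson_pgf_nth)
next
  case (insert i I)
  then show ?case by (simp add: bernoulli_poisson_pgf_insert bernoulli_pgf_mult_nth)
qed

lemma fps_deriv_bernoulli_poisson_pgf:
  assumes "finite I"
  shows "fps_deriv (bernoulli_poisson_pgf p I \<theta>) =
    fps_const \<theta> * bernoulli_poisson_pgf p I \<theta> +
    (\<Sum>i\<in>I. fps_const (p i) * bernoulli_poisson_pgf p I \<theta> +
      fps_const ((p i)\<^sup>2) * ((1 - fps_X) * bernoulli_poisson_pgf p (I - {i}) \<theta>))"
proof -
  let ?F = "\<lambda>I. bernoulli_poisson_pgf p I \<theta>"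
  have "fps_deriv (\<Prod>i\<in>I. bernoulli_pgf (p i)) =
      (\<Sum>i\<in>I. fps_const (p i) * (\<Prod>j\<in>I - {i}. bernoulli_pgf (p j)))"
    by (simp add: fps_deriv_prod bernoulli_pgf_def)
  then have "fps_deriv (?F I) = fps_const \<theta> * ?F I + (\<Sum>i\<in>I. fps_const (p i) * ?F (I - {i}))"
    by (simp add: bernoulli_poisson_pgf_def fps_deriv_poisson_pgf sum_distrib_left mult_ac)
  also have "(\<Sum>i\<in>I. fps_const (p i) * ?F (I - {i})) =
      (\<Sum>i\<in>I. fps_const (p i) * ?F I + fps_const ((p i)\<^sup>2) * ((1 - fps_X) * ?F (I - {i})))"
  proof (intro sum.cong refl)
    fix i assume "i \<in> I"
    then have "?F (I - {i}) = ?F I + fps_const (p i) * ((1 - fps_X) * ?F (I - {i}))"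
      using bernoulli_poisson_pgf_remove[OF assms, of i p \<theta>] by (simp add: bernoulli_pgf_mult)
    then have "fps_const (p i) * ?F (I - {i}) =
        fps_const (p i) * (?F I + fps_const (p i) * ((1 - fps_X) * ?F (I - {i})))"
      by (rule arg_cong)
    then show "fps_const (p i) * ?F (I - {i}) =
        fps_const (p i) * ?F I + fps_const ((p i)\<^sup>2) * ((1 - fps_X) * ?F (I - {i}))"
      by (simp only: distrib_left power2_eq_square mult.assoc flip: fps_const_mult)
  qed
  finally show ?thesis .
qed

text \<open>Removing the \<open>i\<close>-th summand lowers the mean by at most 1, so the terms with weight \<open>p\<^sub>i\<^sup>2\<close> in
  \<open>fps_deriv_bernoulli_poisson_pgf\<close> are covered by the induction hypothesis.\<close>

lemma bernoulli_poisson_pgf_nth_diff_nonneg: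
  assumes "finite I" "\<And>i. i \<in> I \<Longrightarrow> p i \<in> {0..1}" "0 \<le> \<theta>" "real c \<le> \<theta> + (\<Sum>i\<in>I. p i)"
  shows "0 \<le> ((1 - fps_X) * bernoulli_poisson_pgf p I \<theta>) $ c"
  using assms
proof (induction c arbitrary: I)
  case 0
  then show ?case by (simp add: left_diff_distrib bernoulli_poisson_pgf_nth_nonneg)
next
  case (Suc c)
  let ?F = "\<lambda>I. bernoulli_poisson_pgf p I \<theta>" and ?\<mu> = "\<theta> + (\<Sum>i\<in>I. p i)"
  have removed: "0 \<le> ((1 - fps_X) * ?F (I - {i})) $ c" if "i \<in> I" for i
  proof -
    have "(\<Sum>j\<in>I. p j) = p i + (\<Sum>j\<in>I - {i}. p j)" using Suc.prems(1) that by (rule sum.remove)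
    moreover have "p i \<le> 1" using Suc.prems(2)[OF that] by simp
    ultimately have "real c \<le> \<theta> + (\<Sum>j\<in>I - {i}. p j)" using Suc.prems(4) by simp
    then show ?thesis using Suc.prems by (intro Suc.IH) auto
  qed
  have "real (Suc c) * ?F I $ Suc c = fps_deriv (?F I) $ c" by simp
  also have "\<dots> = ?\<mu> * ?F I $ c + (\<Sum>i\<in>I. (p i)\<^sup>2 * ((1 - fps_X) * ?F (I - {i})) $ c)"
    unfolding fps_deriv_bernoulli_poisson_pgf[OF Suc.prems(1)]
    by (simp add: fps_sum_nth sum.distrib distrib_right sum_distrib_right)
  finally have "real (Suc c) * ((1 - fps_X) * ?F I) $ Suc c =
      (?\<mu> - real (Suc c)) * ?F I $ c + (\<Sum>i\<in>I. (p i)\<^sup>2 * ((1 - fps_X) * ?F (I - {i})) $ c)"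
    by (simp add: left_diff_distrib right_diff_distrib)
  also have "\<dots> \<ge> 0"
    using Suc.prems removed
    by (intro add_nonneg_nonneg mult_nonneg_nonneg sum_nonneg bernoulli_poisson_pgf_nth_nonneg) auto
  finally show ?case by (simp add: zero_le_mult_iff del: of_nat_Suc)
qed

lemma DERIV_bernoulli_poisson_pgf_nth:
  "((\<lambda>\<theta>. bernoulli_poisson_pgf p I \<theta> $ c) has_real_derivative
     - (((1 - fps_X) * bernoulli_poisson_pgf p I \<theta>) $ c)) (at \<theta>)"
  unfolding bernoulli_poisson_pgf_def by (rule DERIV_mult_poisson_pgf_nth)

lemma DERIV_cumulative_bernoulli_poisson_pgf_nth:
  "((\<lambda>\<theta>. cumulative_fps (bernoulli_poisson_pgf p I \<theta>) $ c) has_real_derivative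
     - (bernoulli_poisson_pgf p I \<theta> $ c)) (at \<theta>)"
  using DERIV_mult_poisson_pgf_nth[of "cumulative_fps (\<Prod>i\<in>I. bernoulli_pgf (p i))" c \<theta>]
  by (simp only: bernoulli_poisson_pgf_def one_minus_fps_X_mult_cumulative_fps
      flip: cumulative_fps_mult_right)

lemma cumulative_bernoulli_pgf_mult_le:
  assumes "finite I" "\<And>i. i \<in> I \<Longrightarrow> p i \<in> {0..1}" "0 \<le> \<theta>" "0 \<le> q"
    and "real c \<le> \<theta> + (\<Sum>i\<in>I. p i)"
  shows "cumulative_fps (bernoulli_pgf q * bernoulli_poisson_pgf p I \<theta>) $ c
    \<le> cumulative_fps (bernoulli_poisson_pgf p I (\<theta> + q)) $ c"
proof -
  define \<phi> where "\<phi> t = cumulative_fps (bernoulli_poisson_pgf p I t) $ c" for t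
  define w where "w t = bernoulli_poisson_pgf p I t $ c" for t
  have "- w \<theta> * (\<theta> + q - \<theta>) \<le> \<phi> (\<theta> + q) - \<phi> \<theta>"
  proof (rule f''_imp_f'[where C = "{\<theta>..\<theta> + q}"])
    show "(\<phi> has_real_derivative - w t) (at t)" for t
      unfolding \<phi>_def w_def by (rule DERIV_cumulative_bernoulli_poisson_pgf_nth)
    show "((\<lambda>t. - w t) has_real_derivative ((1 - fps_X) * bernoulli_poisson_pgf p I t) $ c) (at t)"
      for t
      using DERIV_minus[OF DERIV_bernoulli_poisson_pgf_nth] by (simp add: w_def)
    show "0 \<le> ((1 - fps_X) * bernoulli_poisson_pgf p I t) $ c" if "t \<in> {\<theta>..\<theta> + q}" for t
      using that assms by (intro bernoulli_poisson_pgf_nth_diff_nonneg) auto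
  qed (use \<open>0 \<le> q\<close> in auto)
  then show ?thesis by (simp add: \<phi>_def w_def cumulative_bernoulli_pgf_mult mult.commute)
qed

lemma cumulative_bernoulli_poisson_pgf_le_poisson_cdf:
  assumes "finite I" "\<And>i. i \<in> I \<Longrightarrow> p i \<in> {0..1}" "0 \<le> \<theta>" "real c + 1 \<le> \<theta> + (\<Sum>i\<in>I. p i)"
  shows "cumulative_fps (bernoulli_poisson_pgf p I \<theta>) $ c
    \<le> poisson_cdf c (\<theta> + (\<Sum>i\<in>I. p i))"
  using assms
proof (induction I arbitrary: \<theta> rule: finite_induct)
  case empty
  then show ?case by (simp add: bernoulli_poisson_pgf_empty poisson_cdf_def)
next
  case (insert i I)
  have "0 \<le> p i" "p i \<le> 1" using insert.prems(1)[of i] by auto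
  then have "real c \<le> \<theta> + (\<Sum>j\<in>I. p j)" using insert.prems(3) insert.hyps by simp
  have "cumulative_fps (bernoulli_poisson_pgf p (insert i I) \<theta>) $ c
      \<le> cumulative_fps (bernoulli_poisson_pgf p I (\<theta> + p i)) $ c"
    unfolding bernoulli_poisson_pgf_insert[OF insert.hyps]
    using insert \<open>0 \<le> p i\<close> \<open>real c \<le> _\<close> by (intro cumulative_bernoulli_pgf_mult_le) auto
  also have "\<dots> \<le> poisson_cdf c (\<theta> + p i + (\<Sum>j\<in>I. p j))"
    using insert \<open>0 \<le> p i\<close> by (intro insert.IH) (auto simp: algebra_simps)
  finally show ?case using insert.hyps by (simp add: add.assoc)
qed

section \<open>The lower tail of the Poisson distribution\<close>

lemma poisson_cdf_0: "poisson_cdf m 0 = 1"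
  by (simp add: poisson_cdf_def poisson_pgf_0 cumulative_fps_nth)

lemma DERIV_poisson_cdf: "(poisson_cdf m has_real_derivative - (poisson_pgf x $ m)) (at x)"
  using DERIV_cumulative_bernoulli_poisson_pgf_nth[of _ "{}" m x]
  by (simp add: bernoulli_poisson_pgf_empty poisson_cdf_def[abs_def])

lemma poisson_cdf_tendsto_0: "(poisson_cdf m \<longlongrightarrow> 0) at_top"
proof -
  have "((\<lambda>x::real. \<Sum>i = 0..m. x ^ i / exp x / fact i) \<longlongrightarrow> (\<Sum>i = 0..m. 0 / fact i)) at_top"
    by (intro tendsto_sum tendsto_divide[OF tendsto_power_div_exp_0 tendsto_const] fact_nonzero)
  moreover have "(\<lambda>x. \<Sum>i = 0..m. x ^ i / exp x / fact i) = poisson_cdf m"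
    by (auto simp: poisson_cdf_eq sum_distrib_left exp_minus field_simps intro!: ext sum.cong)
  ultimately show ?thesis by simp
qed

lemma poisson_pgf_nth_exp_le:
  assumes "0 \<le> s"
  shows "poisson_pgf (real k * exp s) $ k \<le> poisson_pgf (real k * exp (- s)) $ k"
proof -
  have weight: "poisson_pgf (real k * exp r) $ k = real k ^ k / fact k * exp (real k * (r - exp r))"
    for r
  proof -
    have "exp (real k * (r - exp r)) = exp (- (real k * exp r)) * exp r ^ k"
      unfolding exp_of_nat_mult[symmetric] exp_add[symmetric] by (simp add: algebra_simps)
    then show ?thesis by (simp add: poisson_pgf_nth power_mult_distrib)
  qed
  have "s - exp s \<le> - s - exp (- s)"
    using real_le_x_sinh[OF assms] by (simp add: exp_minus)
  then show ?thesis
    unfolding weight by (intro mult_left_mono) (auto intro: mult_left_mono)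
qed

lemma poisson_cdf_exp_add_exp_minus_le:
  fixes m :: nat
  defines "k \<equiv> real (Suc m)"
  assumes "0 \<le> s" "s \<le> t"
  shows "poisson_cdf m (k * exp s) + poisson_cdf m (k * exp (- s))
    \<le> poisson_cdf m (k * exp t) + poisson_cdf m (k * exp (- t))"
proof (rule DERIV_nonneg_imp_nondecreasing[OF \<open>s \<le> t\<close>])
  fix r assume "s \<le> r"
  let ?w = "\<lambda>x. poisson_pgf x $ Suc m"
  have weight: "x * poisson_pgf x $ m = k * ?w x" for x
    by (simp add: poisson_pgf_nth k_def mult_ac del: of_nat_Suc)
  have "((\<lambda>s. poisson_cdf m (k * exp s) + poisson_cdf m (k * exp (- s))) has_real_derivative
      - (poisson_pgf (k * exp r) $ m) * (k * exp r) +
      - (poisson_pgf (k * exp (- r)) $ m) * - (k * exp (- r))) (at r)"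
    by (intro DERIV_add DERIV_chain2[OF DERIV_poisson_cdf]) (auto intro!: derivative_eq_intros)
  also have "- (poisson_pgf (k * exp r) $ m) * (k * exp r) +
      - (poisson_pgf (k * exp (- r)) $ m) * - (k * exp (- r)) =
      k * (?w (k * exp (- r)) - ?w (k * exp r))"
    by (simp add: weight right_diff_distrib mult.commute[of "poisson_pgf _ $ m"])
  finally have "((\<lambda>s. poisson_cdf m (k * exp s) + poisson_cdf m (k * exp (- s))) has_real_derivative
      k * (?w (k * exp (- r)) - ?w (k * exp r))) (at r)" .
  moreover have "0 \<le> k * (?w (k * exp (- r)) - ?w (k * exp r))"
    using poisson_pgf_nth_exp_le[of r "Suc m"] \<open>0 \<le> s\<close> \<open>s \<le> r\<close> by (simp add: k_def)
  ultimately show "\<exists>y. ((\<lambda>s. poisson_cdf m (k * exp s) + poisson_cdf m (k * exp (- s)))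
      has_real_derivative y) (at r) \<and> 0 \<le> y"
    by blast
qed

lemma poisson_cdf_exp_add_exp_minus_tendsto_1:
  assumes "0 < k"
  shows "((\<lambda>s. poisson_cdf m (k * exp s) + poisson_cdf m (k * exp (- s))) \<longlongrightarrow> 1) at_top"
proof -
  have "filterlim (\<lambda>s. k * exp s) at_top at_top"
    using assms by (intro filterlim_tendsto_pos_mult_at_top[OF tendsto_const] exp_at_top)
  then have "((\<lambda>s. poisson_cdf m (k * exp s)) \<longlongrightarrow> 0) at_top"
    by (rule filterlim_compose[OF poisson_cdf_tendsto_0])
  moreover have "((\<lambda>s. k * exp (- s)) \<longlongrightarrow> k * 0) at_top"
    by (intro tendsto_mult tendsto_const filterlim_compose[OF exp_at_bot filterlim_uminus_at_bot_at_top])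
  then have "((\<lambda>s. poisson_cdf m (k * exp (- s))) \<longlongrightarrow> poisson_cdf m (k * 0)) at_top"
    by (rule isCont_tendsto_compose[OF DERIV_isCont[OF DERIV_poisson_cdf]])
  ultimately have "((\<lambda>s. poisson_cdf m (k * exp s) + poisson_cdf m (k * exp (- s)))
      \<longlongrightarrow> 0 + poisson_cdf m (k * 0)) at_top"
    by (rule tendsto_add)
  then show ?thesis by (simp add: poisson_cdf_0)
qed

lemma poisson_cdf_at_Suc_le_half: "poisson_cdf m (real (Suc m)) \<le> 1 / 2"
proof -
  define k where "k = real (Suc m)"
  define H where "H s = poisson_cdf m (k * exp s) + poisson_cdf m (k * exp (- s))" for s
  have "(H \<longlongrightarrow> 1) at_top"
    unfolding H_def by (rule poisson_cdf_exp_add_exp_minus_tendsto_1) (simp add: k_def)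
  moreover have "eventually (\<lambda>s. H 0 \<le> H s) at_top"
    using eventually_ge_at_top[of 0]
    by eventually_elim (auto simp only: H_def k_def intro!: poisson_cdf_exp_add_exp_minus_le)
  ultimately have "H 0 \<le> 1" by (rule tendsto_lowerbound) simp
  then show ?thesis by (simp add: H_def k_def)
qed

lemma poisson_cdf_le_Suc_mult_pgf_nth:
  assumes "real m \<le> x"
  shows "poisson_cdf m x \<le> real (Suc m) * poisson_pgf x $ m"
proof -
  have step: "poisson_pgf x $ i \<le> poisson_pgf x $ Suc i" if "i < m" for i
    using bernoulli_poisson_pgf_nth_diff_nonneg[of "{}" _ x "Suc i"] that assms
    by (simp add: bernoulli_poisson_pgf_empty left_diff_distrib)
  have "poisson_pgf x $ i \<le> poisson_pgf x $ m" if "i \<le> m" for i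
    using that by (induction rule: inc_induct) (auto intro: order_trans step)
  then have "(\<Sum>i\<le>m. poisson_pgf x $ i) \<le> (\<Sum>i\<le>m. poisson_pgf x $ m)"
    by (intro sum_mono) auto
  then show ?thesis by (simp add: poisson_cdf_def cumulative_fps_nth)
qed

lemma exp_mult_poisson_cdf_antimono:
  fixes m :: nat
  defines "k \<equiv> real (Suc m)"
  assumes "real m \<le> x" "x \<le> y"
  shows "exp (y / k) * poisson_cdf m y \<le> exp (x / k) * poisson_cdf m x"
proof (rule DERIV_nonpos_imp_nonincreasing[OF \<open>x \<le> y\<close>])
  fix t assume "x \<le> t"
  have k_pos: "0 < k" by (simp add: k_def)
  have "((\<lambda>x. exp (x / k) * poisson_cdf m x) has_real_derivative
      exp (t / k) * (poisson_cdf m t / k - poisson_pgf t $ m)) (at t)"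
    using k_pos by (auto intro!: derivative_eq_intros DERIV_poisson_cdf simp: algebra_simps)
  moreover have "poisson_cdf m t / k \<le> poisson_pgf t $ m"
    using poisson_cdf_le_Suc_mult_pgf_nth[of m t] \<open>x \<le> t\<close> assms(2) k_pos
    by (simp add: k_def divide_le_eq mult.commute)
  then have "exp (t / k) * (poisson_cdf m t / k - poisson_pgf t $ m) \<le> 0"
    by (simp add: mult_le_0_iff)
  ultimately show "\<exists>d. ((\<lambda>x. exp (x / k) * poisson_cdf m x) has_real_derivative d) (at t) \<and> d \<le> 0"
    by blast
qed

lemma poisson_cdf_le_exp:
  assumes "real (Suc m) \<le> x"
  shows "poisson_cdf m x \<le> exp (- (x / real (Suc m))) * (exp 1 / 2)"
proof -
  define k where "k = real (Suc m)"
  have "exp (x / k) * poisson_cdf m x \<le> exp (k / k) * poisson_cdf m k"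
    unfolding k_def by (rule exp_mult_poisson_cdf_antimono) (use assms in auto)
  also have "\<dots> \<le> exp 1 * (1 / 2)"
    using poisson_cdf_at_Suc_le_half[of m] by (simp add: k_def)
  finally show ?thesis by (simp add: k_def exp_minus field_simps)
qed

section \<open>Sums of independent Bernoulli variables\<close>

context prob_space
begin

lemma bernoulli_distributed_measurable:
  "bernoulli_distributed X q \<Longrightarrow> X \<in> borel_measurable M"
  by (simp add: bernoulli_distributed_def)

lemma bernoulli_distributed_AE:
  assumes "bernoulli_distributed X q"
  shows "AE \<omega> in M. X \<omega> = 0 \<or> X \<omega> = 1"
proof -
  have "AE x in distr (measure_pmf (bernoulli_pmf q)) borel of_bool. x = (0::real) \<or> x = 1"
    by (simp add: AE_distr_iff)
  moreover have "distr M borel X = distr (measure_pmf (bernoulli_pmf q)) borel of_bool"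
    using assms by (simp add: bernoulli_distributed_def)
  ultimately have "AE x in distr M borel X. x = 0 \<or> x = 1" by (simp only:)
  then show ?thesis
    using bernoulli_distributed_measurable[OF assms] by (simp add: AE_distr_iff)
qed

lemma bernoulli_distributed_integrable:
  assumes "bernoulli_distributed X q"
  shows "integrable M X"
proof (rule integrable_const_bound[where B = 1])
  show "AE \<omega> in M. norm (X \<omega>) \<le> 1"
    using bernoulli_distributed_AE[OF assms] by eventually_elim auto
qed (rule bernoulli_distributed_measurable[OF assms])

lemma bernoulli_distributed_expectation_comp:
  fixes f :: "real \<Rightarrow> real"
  assumes bernoulli: "bernoulli_distributed X q" and "q \<in> {0..1}"
    and [measurable]: "f \<in> borel_measurable borel"
  shows "expectation (\<lambda>\<omega>. f (X \<omega>)) = f 1 * q + f 0 * (1 - q)"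
proof -
  note [measurable] = bernoulli_distributed_measurable[OF bernoulli]
  have "expectation (\<lambda>\<omega>. f (X \<omega>)) = (\<integral>x. f x \<partial>distr M borel X)"
    by (simp add: integral_distr)
  also have "\<dots> = (\<integral>x. f x \<partial>distr (measure_pmf (bernoulli_pmf q)) borel of_bool)"
    using bernoulli by (simp add: bernoulli_distributed_def)
  also have "\<dots> = measure_pmf.expectation (bernoulli_pmf q) (\<lambda>b. f (of_bool b))"
    by (simp add: integral_distr)
  also have "\<dots> = f 1 * q + f 0 * (1 - q)"
    using \<open>q \<in> {0..1}\<close> by (subst integral_bernoulli_pmf) auto
  finally show ?thesis .
qed

lemma bernoulli_distributed_prob_vimage:
  assumes "bernoulli_distributed X q" "q \<in> {0..1}" "A \<in> sets borel"
  shows "prob (X -` A \<inter> space M) = indicator A 1 * q + indicator A 0 * (1 - q)"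
proof -
  have "prob (X -` A \<inter> space M) = expectation (indicator (X -` A))" by simp
  also have "\<dots> = expectation (\<lambda>\<omega>. indicator A (X \<omega>))"
    by (intro Bochner_Integration.integral_cong) (auto simp: indicator_def)
  finally show ?thesis
    using bernoulli_distributed_expectation_comp[OF assms(1,2), of "indicator A"] assms(3) by simp
qed

lemma expectation_sum_bernoulli:
  assumes "\<And>i. i \<in> I \<Longrightarrow> p i \<in> {0..1}" "\<And>i. i \<in> I \<Longrightarrow> bernoulli_distributed (X i) (p i)"
  shows "expectation (\<lambda>\<omega>. \<Sum>i\<in>I. X i \<omega>) = (\<Sum>i\<in>I. p i)"
proof -
  have "expectation (\<lambda>\<omega>. \<Sum>i\<in>I. X i \<omega>) = (\<Sum>i\<in>I. expectation (X i))"
    using assms(2) by (intro Bochner_Integration.integral_sum bernoulli_distributed_integrable)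
  also have "\<dots> = (\<Sum>i\<in>I. p i)"
    using bernoulli_distributed_expectation_comp[where f = "\<lambda>x. x"] assms by (intro sum.cong) auto
  finally show ?thesis .
qed

lemma prob_bernoulli_add_le:
  assumes bernoulli: "bernoulli_distributed X q" "q \<in> {0..1}"
    and indep: "indep_var borel X borel Y"
  shows "prob {\<omega> \<in> space M. X \<omega> + Y \<omega> \<le> c} =
    (1 - q) * prob {\<omega> \<in> space M. Y \<omega> \<le> c} + q * prob {\<omega> \<in> space M. Y \<omega> \<le> c - 1}"
proof -
  note [measurable] = indep_var_rv1[OF indep] indep_var_rv2[OF indep]
  have prod: "prob {\<omega> \<in> space M. X \<omega> = x \<and> Y \<omega> \<le> d} =
      prob (X -` {x} \<inter> space M) * prob {\<omega> \<in> space M. Y \<omega> \<le> d}" for x d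
    using indep_varD[OF indep, of "{x}" "{..d}"]
    by (simp add: vimage_def Int_def conj_commute conj_left_commute)
  have "prob {\<omega> \<in> space M. X \<omega> + Y \<omega> \<le> c} =
      prob ({\<omega> \<in> space M. X \<omega> = 0 \<and> Y \<omega> \<le> c} \<union> {\<omega> \<in> space M. X \<omega> = 1 \<and> Y \<omega> \<le> c - 1})"
    using bernoulli_distributed_AE[OF bernoulli(1)] by (intro measure_eq_AE) auto
  also have "\<dots> = prob {\<omega> \<in> space M. X \<omega> = 0 \<and> Y \<omega> \<le> c} + prob {\<omega> \<in> space M. X \<omega> = 1 \<and> Y \<omega> \<le> c - 1}"
    by (intro finite_measure_Union) auto
  finally show ?thesis by (simp add: prod bernoulli_distributed_prob_vimage[OF bernoulli])
qed

lemma prob_sum_bernoulli_le_neg: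
  assumes "finite I" "\<And>i. i \<in> I \<Longrightarrow> bernoulli_distributed (X i) (p i)" "c < 0"
  shows "prob {\<omega> \<in> space M. (\<Sum>i\<in>I. X i \<omega>) \<le> c} = 0"
proof -
  have "AE \<omega> in M. \<forall>i\<in>I. X i \<omega> = 0 \<or> X i \<omega> = 1"
    using assms(1,2) by (intro AE_finite_allI bernoulli_distributed_AE)
  then have "AE \<omega> in M. 0 \<le> (\<Sum>i\<in>I. X i \<omega>)"
    by eventually_elim (auto intro!: sum_nonneg)
  then have "AE \<omega> in M. \<not> (\<Sum>i\<in>I. X i \<omega>) \<le> c"
    by eventually_elim (use \<open>c < 0\<close> in simp)
  moreover have "(\<lambda>\<omega>. \<Sum>i\<in>I. X i \<omega>) \<in> borel_measurable M"
    using assms(2) by (intro borel_measurable_sum bernoulli_distributed_measurable)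
  ultimately show ?thesis
    by (simp add: prob_Collect_eq_0)
qed

lemma prob_sum_bernoulli_le:
  assumes "finite I" "\<And>i. i \<in> I \<Longrightarrow> p i \<in> {0..1}"
    and "\<And>i. i \<in> I \<Longrightarrow> bernoulli_distributed (X i) (p i)" "indep_vars (\<lambda>_. borel) X I"
  shows "prob {\<omega> \<in> space M. (\<Sum>i\<in>I. X i \<omega>) \<le> real c} =
    cumulative_fps (\<Prod>i\<in>I. bernoulli_pgf (p i)) $ c"
  using assms
proof (induction I arbitrary: c rule: finite_induct)
  case empty
  then show ?case by (simp add: prob_space cumulative_fps_nth)
next
  case (insert i I)
  let ?F = "cumulative_fps (\<Prod>i\<in>I. bernoulli_pgf (p i))"
  let ?Y = "\<lambda>\<omega>. \<Sum>i\<in>I. X i \<omega>"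
  have IH: "prob {\<omega> \<in> space M. ?Y \<omega> \<le> real c} = ?F $ c" for c
    using insert.prems by (intro insert.IH indep_vars_subset[OF insert.prems(3)]) auto
  have pred: "prob {\<omega> \<in> space M. ?Y \<omega> \<le> real c - 1} = (if c = 0 then 0 else ?F $ (c - 1))"
  proof (cases c)
    case 0
    then show ?thesis using insert prob_sum_bernoulli_le_neg[of I X p "- 1"] by simp
  next
    case (Suc m)
    then show ?thesis using IH[of m] by simp
  qed
  have "indep_var borel (X i) borel ?Y"
    using insert by (intro indep_vars_sum) auto
  then have "prob {\<omega> \<in> space M. X i \<omega> + ?Y \<omega> \<le> real c} =
      (1 - p i) * ?F $ c + p i * (if c = 0 then 0 else ?F $ (c - 1))"
    using insert.prems by (subst prob_bernoulli_add_le[where q = "p i"]) (auto simp: IH pred)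
  then show ?case
    using insert.hyps by (simp add: cumulative_fps_mult_left bernoulli_pgf_mult_nth)
qed

lemma prob_sum_bernoulli_le_poisson_cdf:
  assumes "finite I" "\<And>i. i \<in> I \<Longrightarrow> p i \<in> {0..1}"
    and "\<And>i. i \<in> I \<Longrightarrow> bernoulli_distributed (X i) (p i)" "indep_vars (\<lambda>_. borel) X I"
    and "real c + 1 \<le> (\<Sum>i\<in>I. p i)"
  shows "prob {\<omega> \<in> space M. (\<Sum>i\<in>I. X i \<omega>) \<le> real c} \<le> poisson_cdf c (\<Sum>i\<in>I. p i)"
proof -
  have "prob {\<omega> \<in> space M. (\<Sum>i\<in>I. X i \<omega>) \<le> real c} =
      cumulative_fps (bernoulli_poisson_pgf p I 0) $ c"
    using prob_sum_bernoulli_le[where X = X and p = p] assms(1-4)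
    by (simp add: bernoulli_poisson_pgf_def poisson_pgf_0)
  also have "\<dots> \<le> poisson_cdf c (\<Sum>i\<in>I. p i)"
    using cumulative_bernoulli_poisson_pgf_le_poisson_cdf[of I p 0 c] assms(1,2,5) by simp
  finally show ?thesis .
qed

end

theorem theorem10:
  fixes M :: "'a measure"
    and X :: "nat \<Rightarrow> 'a \<Rightarrow> real"
    and p :: "nat \<Rightarrow> real"
    and n k :: nat
    and S :: "'a \<Rightarrow> real"
    and lam \<gamma> :: real
  assumes "prob_space M"
    and "\<And>i. i \<in> {1..n} \<Longrightarrow> p i \<in> {0..1}"
    and "\<And>i. i \<in> {1..n} \<Longrightarrow> prob_space.bernoulli_distributed M (X i) (p i)"
    and "prob_space.indep_vars M (\<lambda>_. borel) X {1..n}"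
    and "S = (\<lambda>\<omega>. \<Sum>i = 1..n. X i \<omega>)"
    and "k > 0"
    and "real k \<le> prob_space.expectation M S"
    and "lam = prob_space.expectation M S"
    and "\<gamma> = prob_space.expectation M S / real k"
  shows "prob_space.prob M {\<omega> \<in> space M. S \<omega> \<le> real k - 1}
           \<le> exp (- lam) * (\<Sum>i = 0..k - 1. lam ^ i / fact i)
       \<and> exp (- lam) * (\<Sum>i = 0..k - 1. lam ^ i / fact i) \<le> exp (- \<gamma>) * (exp 1 / 2)"
proof -
  interpret prob_space M by fact
  obtain m where "k = Suc m" using \<open>k > 0\<close> by (cases k) auto
  have lam_eq: "lam = (\<Sum>i = 1..n. p i)"
    unfolding \<open>lam = _\<close> \<open>S = _\<close> using assms(2,3) by (rule expectation_sum_bernoulli)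
  have "real (Suc m) \<le> lam" using assms(7,8) \<open>k = Suc m\<close> by simp
  then have "prob {\<omega> \<in> space M. S \<omega> \<le> real m} \<le> poisson_cdf m lam"
    unfolding \<open>S = _\<close> lam_eq using assms(2-4) by (intro prob_sum_bernoulli_le_poisson_cdf) auto
  moreover have "poisson_cdf m lam \<le> exp (- \<gamma>) * (exp 1 / 2)"
    using poisson_cdf_le_exp[OF \<open>real (Suc m) \<le> lam\<close>] assms(8,9) \<open>k = Suc m\<close> by simp
  ultimately show ?thesis by (simp add: \<open>k = Suc m\<close> poisson_cdf_eq)
qed

end
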